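(* Let $l_1, m_1, l_2, m_2$ be positive integers with $l_1 \le m_1 < l_2 \le m_2$, and let $k$ be a positive integer. Then (a) $\displaystyle f([l_1,m_1]\cup[l_2,m_2]) = \sum_{d=1}^{m_2} \mu(d)\left(2^{\lfloor m_1/d\rfloor + \lfloor m_2/d\rfloor - \lfloor (l_1-1)/d\rfloor - \lfloor (l_2-1)/d\rfloor} - 1\right)$; (b) $\displaystyle f_k([l_1,m_1]\cup[l_2,m_2]) = \sum_{d=1}^{m_2} \mu(d) \binom{\lfloor m_1/d\rfloor + \lfloor m_2/d\rfloor - \lfloor (l_1-1)/d\rfloor - \lfloor (l_2-1)/d\rfloor}{k}$.
   Context: For positive integers $l \le m$, $[l,m] = \{l, l+1, \ldots, m\}$. For a nonempty finite set $A$ of positive integers, $f(A)$ is the number of nonempty subsets $X \subseteq A$ with $\gcd(X) = 1$, and $f_k(A)$ is the number of subsets $X \subseteq A$ with $\#X = k$ and $\gcd(X)=1$. $\mu$ is the Möbius function and $\lfloor x\rfloor$ the floor of $x$. *)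

theory Defs
  imports "HOL-Computational_Algebra.Computational_Algebra"
begin

definition moebius_mu :: "nat \<Rightarrow> int" where
  "moebius_mu n = (if squarefree n then (- 1) ^ card (prime_factors n) else 0)"

definition num_coprime_subsets :: "nat set \<Rightarrow> nat" where
  "num_coprime_subsets A = card {X. X \<subseteq> A \<and> X \<noteq> {} \<and> Gcd X = 1}"

definition num_coprime_subsets_card :: "nat \<Rightarrow> nat set \<Rightarrow> nat" where
  "num_coprime_subsets_card k A = card {X. X \<subseteq> A \<and> card X = k \<and> Gcd X = 1}"

end

theory Submission
  imports Defs
begin

text \<open>
  Since the Moebius function sums to \<open>0\<close> over the divisors of any \<open>n > 1\<close>, the indicator of
  \<open>Gcd X = 1\<close> is the sum of \<open>\<mu>(d)\<close> over the common divisors \<open>d\<close> of \<open>X\<close>. Exchanging the order of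
  summation reduces the count to the number of subsets of the multiples of \<open>d\<close> in the ground set.
\<close>

text \<open>A new prime keeps the product squarefree and adds exactly one prime factor, which flips
  the sign.\<close>

lemma moebius_mu_prime_mult:
  assumes "prime p" "\<not> p dvd d" "squarefree d"
  shows "moebius_mu (p * d) = - moebius_mu d"
proof -
  have "d \<noteq> 0" "p \<noteq> 0"
    using assms by (auto intro!: Nat.gr0I)
  then have "prime_factors (p * d) = insert p (prime_factors d)"
    using assms(1) by (simp add: prime_factors_product prime_factorization_prime)
  moreover have "p \<notin> prime_factors d"
    using assms(2) by auto
  moreover have "squarefree (p * d)"
    using assms by (intro squarefree_mult_coprime) (auto intro: prime_imp_coprime squarefree_prime)
  ultimately show ?thesis
    using assms(3) by (simp add: moebius_mu_def)
qed

text \<open>For a prime \<open>p\<close> dividing \<open>n\<close>, the map \<open>d \<mapsto> p d\<close> pairs the squarefree divisors of \<open>n\<close> prime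
  to \<open>p\<close> with the remaining ones, reversing the sign.\<close>

lemma sum_moebius_mu_divisors:
  assumes "n > 0"
  shows "(\<Sum>d | d dvd n. moebius_mu d) = (if n = 1 then 1 else 0)"
proof (cases "n = 1")
  case True
  then show ?thesis by (simp add: moebius_mu_def)
next
  case False
  then obtain p where p: "prime p" "p dvd n"
    using prime_factor_nat by blast
  define D where "D = {d. d dvd n \<and> squarefree d \<and> \<not> p dvd d}"
  have fin: "finite {d. d dvd n}"
    using assms by simp
  have "finite D"
    using fin by (rule rev_finite_subset) (auto simp: D_def)
  have mult_mem: "p * d dvd n \<and> squarefree (p * d)" if "d \<in> D" for d
  proof -
    have "coprime p d"
      using that p(1) by (auto simp: D_def intro: prime_imp_coprime)
    then show ?thesis
      using that p by (auto simp: D_def intro: divides_mult squarefree_mult_coprime squarefree_prime)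
  qed
  \<comment> \<open>The preimage is the cofactor of \<open>p\<close>; a second factor
    \<open>p\<close> in it would put a square into \<open>d\<close>.\<close>
  have "d \<in> (\<lambda>d. p * d) ` D" if d: "d dvd n" "squarefree d" "p dvd d" for d
  proof -
    obtain e where e: "d = p * e"
      using d(3) by blast
    have "\<not> p dvd e"
    proof
      assume "p dvd e"
      then have "p\<^sup>2 dvd d"
        by (simp add: e power2_eq_square)
      then show False
        using squarefreeD[OF d(2)] p(1) not_prime_unit by blast
    qed
    moreover have "squarefree e" "e dvd n"
      using d e squarefree_mono[of e d] dvd_trans[of e d n] by auto
    ultimately show ?thesis
      using e by (auto simp: D_def)
  qed
  then have split: "{d. d dvd n \<and> squarefree d} = D \<union> (\<lambda>d. p * d) ` D"
    using mult_mem by (auto simp: D_def)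
  have "inj_on (\<lambda>d. p * d) D"
    using p(1) by (auto simp: inj_on_def)
  have "(\<Sum>d | d dvd n. moebius_mu d) = (\<Sum>d | d dvd n \<and> squarefree d. moebius_mu d)"
    using fin by (intro sum.mono_neutral_right) (auto simp: moebius_mu_def)
  also have "\<dots> = (\<Sum>d\<in>D. moebius_mu d) + (\<Sum>d\<in>(\<lambda>d. p * d) ` D. moebius_mu d)"
    unfolding split by (intro sum.union_disjoint finite_imageI \<open>finite D\<close>) (auto simp: D_def)
  also have "(\<Sum>d\<in>(\<lambda>d. p * d) ` D. moebius_mu d) = (\<Sum>d\<in>D. moebius_mu (p * d))"
    using \<open>inj_on _ D\<close> by (simp add: sum.reindex)
  also have "\<dots> = (\<Sum>d\<in>D. - moebius_mu d)"
    using p(1) by (intro sum.cong refl moebius_mu_prime_mult) (auto simp: D_def)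
  finally show ?thesis
    using False by (simp add: sum_negf)
qed

text \<open>Moebius inversion over an abstract family \<open>F\<close>, so that it serves both the
  nonempty subsets and the subsets of size \<open>k\<close>.\<close>

lemma card_Gcd_eq_1_moebius:
  fixes F :: "nat set set"
  assumes "finite F" and F: "\<And>X. X \<in> F \<Longrightarrow> X \<noteq> {} \<and> X \<subseteq> {1..M}"
  shows "int (card {X \<in> F. Gcd X = 1}) =
    (\<Sum>d = 1..M. moebius_mu d * int (card {X \<in> F. \<forall>x\<in>X. d dvd x}))"
proof -
  have "(\<Sum>d = 1..M. if \<forall>x\<in>X. d dvd x then moebius_mu d else 0) = (if Gcd X = 1 then 1 else 0)"
    if X: "X \<in> F" for X
  proof -
    \<comment> \<open>This one positive element rules out \<open>Gcd X = 0\<close> and bounds every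
      common divisor by \<open>M\<close>, so the range \<open>1..M\<close> misses none.\<close>
    obtain x where x: "x \<in> X" "1 \<le> x" "x \<le> M"
      using F[OF X] by fastforce
    then have "Gcd X > 0"
      using Gcd_0_iff[of X] by (auto intro!: Nat.gr0I)
    have "{d \<in> {1..M}. \<forall>x\<in>X. d dvd x} = {d. d dvd Gcd X}"
    proof safe
      fix d assume d: "d dvd Gcd X"
      then have "d dvd x"
        using x(1) by (auto intro: dvd_trans)
      then show "d \<in> {1..M}"
        using x dvd_imp_le[of d x] by (auto intro!: Suc_leI Nat.gr0I)
    next
      fix d y assume "d dvd Gcd X" "y \<in> X"
      then show "d dvd y"
        by (auto intro: dvd_trans)
    qed (auto intro: Gcd_greatest)
    then show ?thesis
      using sum_moebius_mu_divisors[OF \<open>Gcd X > 0\<close>] by (simp flip: sum.inter_filter)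
  qed
  then have "int (card {X \<in> F. Gcd X = 1}) =
      (\<Sum>X\<in>F. \<Sum>d = 1..M. if \<forall>x\<in>X. d dvd x then moebius_mu d else 0)"
    using assms(1) by (simp flip: sum.inter_filter)
  also have "\<dots> = (\<Sum>d = 1..M. \<Sum>X\<in>F. if \<forall>x\<in>X. d dvd x then moebius_mu d else 0)"
    by (rule sum.swap)
  also have "\<dots> = (\<Sum>d = 1..M. moebius_mu d * int (card {X \<in> F. \<forall>x\<in>X. d dvd x}))"
    using assms(1) by (simp add: mult.commute flip: sum.inter_filter)
  finally show ?thesis .
qed

text \<open>The nonempty sets with all elements divisible by \<open>d\<close> are the nonempty
  subsets of the multiples of \<open>d\<close> in \<open>A\<close>; the \<open>- 1\<close> discards
  the empty set.\<close>

lemma num_coprime_subsets_moebius: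
  assumes "A \<subseteq> {1..M}"
  shows "int (num_coprime_subsets A) =
    (\<Sum>d = 1..M. moebius_mu d * (2 ^ card {x \<in> A. d dvd x} - 1))"
proof -
  have fin: "finite A"
    using assms finite_subset by blast
  have "card {X \<in> Pow A - {{}}. \<forall>x\<in>X. d dvd x} = 2 ^ card {x \<in> A. d dvd x} - 1" for d
  proof -
    have "{X \<in> Pow A - {{}}. \<forall>x\<in>X. d dvd x} = Pow {x \<in> A. d dvd x} - {{}}"
      by auto
    then show ?thesis
      using fin by (simp add: card_Diff_subset card_Pow)
  qed
  moreover have "{X. X \<subseteq> A \<and> X \<noteq> {} \<and> Gcd X = 1} = {X \<in> Pow A - {{}}. Gcd X = 1}"
    by auto
  ultimately show ?thesis
    using card_Gcd_eq_1_moebius[of "Pow A - {{}}" M] fin assms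
    by (auto simp: num_coprime_subsets_def of_nat_diff)
qed

lemma num_coprime_subsets_card_moebius:
  assumes "A \<subseteq> {1..M}" "k > 0"
  shows "int (num_coprime_subsets_card k A) =
    (\<Sum>d = 1..M. moebius_mu d * int (card {x \<in> A. d dvd x} choose k))"
proof -
  have fin: "finite A"
    using assms finite_subset by blast
  define F where "F = {X. X \<subseteq> A \<and> card X = k}"
  have "card {X \<in> F. \<forall>x\<in>X. d dvd x} = card {x \<in> A. d dvd x} choose k" for d
  proof -
    have "{X \<in> F. \<forall>x\<in>X. d dvd x} = {X. X \<subseteq> {x \<in> A. d dvd x} \<and> card X = k}"
      by (auto simp: F_def)
    then show ?thesis
      using fin by (simp add: n_subsets)
  qed
  moreover have "num_coprime_subsets_card k A = card {X \<in> F. Gcd X = 1}"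
    by (simp add: num_coprime_subsets_card_def F_def conj_assoc)
  moreover have "finite F"
    using fin by (simp add: F_def)
  \<comment> \<open>Here \<open>k > 0\<close> keeps the empty set out of \<open>F\<close>.\<close>
  moreover have "X \<noteq> {} \<and> X \<subseteq> {1..M}" if "X \<in> F" for X
    using that assms by (auto simp: F_def)
  ultimately show ?thesis
    using card_Gcd_eq_1_moebius[of F M] by simp
qed

text \<open>The multiples \<open>d * j\<close> in the interval are indexed by a half-open range of
  \<open>j\<close>. Reading \<open>l \<le> d * j\<close> as \<open>l - 1 < d * j\<close> turns the
  lower bound, a ceiling, into a floor.\<close>

lemma card_multiples_atLeastAtMost:
  fixes d l m :: nat
  assumes "d > 0" "l > 0"
  shows "card {x \<in> {l..m}. d dvd x} = m div d - (l - 1) div d"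
proof -
  have "l \<le> d * j \<longleftrightarrow> (l - 1) div d < j" for j
    using assms by (auto simp: div_less_iff_less_mult mult.commute)
  moreover have "d * j \<le> m \<longleftrightarrow> j \<le> m div d" for j
    using assms by (simp add: less_eq_div_iff_mult_less_eq mult.commute)
  ultimately have "{x \<in> {l..m}. d dvd x} = (\<lambda>j. d * j) ` {(l - 1) div d<..m div d}"
    by (auto elim!: dvdE)
  moreover have "inj_on (\<lambda>j. d * j) {(l - 1) div d<..m div d}"
    using assms by (auto simp: inj_on_def)
  ultimately show ?thesis
    by (simp add: card_image)
qed

lemma card_multiples_two_intervals:
  fixes d l1 m1 l2 m2 :: nat
  assumes "d > 0" "0 < l1" "l1 \<le> m1" "m1 < l2" "l2 \<le> m2"
  shows "card {x \<in> {l1..m1} \<union> {l2..m2}. d dvd x} =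
    m1 div d + m2 div d - (l1 - 1) div d - (l2 - 1) div d"
proof -
  have "{x \<in> {l1..m1} \<union> {l2..m2}. d dvd x} = {x \<in> {l1..m1}. d dvd x} \<union> {x \<in> {l2..m2}. d dvd x}"
    by auto
  moreover have "{x \<in> {l1..m1}. d dvd x} \<inter> {x \<in> {l2..m2}. d dvd x} = {}"
    using assms by auto
  \<comment> \<open>With these bounds the truncated subtractions on \<open>nat\<close> are exact, so
    the two interval counts add up to the single expression in the statement.\<close>
  moreover have "(l1 - 1) div d \<le> m1 div d" "(l2 - 1) div d \<le> m2 div d"
    using assms by (auto intro!: div_le_mono)
  moreover have "card {x \<in> {l1..m1}. d dvd x} = m1 div d - (l1 - 1) div d"
      "card {x \<in> {l2..m2}. d dvd x} = m2 div d - (l2 - 1) div d"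
    using assms by (intro card_multiples_atLeastAtMost; simp)+
  ultimately show ?thesis
    by (simp add: card_Un_disjoint)
qed

theorem theorem3:
  fixes l1 m1 l2 m2 k :: nat
  assumes "0 < l1" and "l1 \<le> m1" and "m1 < l2" and "l2 \<le> m2" and "0 < k"
  shows "int (num_coprime_subsets ({l1..m1} \<union> {l2..m2})) =
           (\<Sum>d = 1..m2. moebius_mu d *
              (2 ^ (m1 div d + m2 div d - (l1 - 1) div d - (l2 - 1) div d) - 1)) \<and>
         int (num_coprime_subsets_card k ({l1..m1} \<union> {l2..m2})) =
           (\<Sum>d = 1..m2. moebius_mu d *
              int ((m1 div d + m2 div d - (l1 - 1) div d - (l2 - 1) div d) choose k))"
proof -
  have "{l1..m1} \<union> {l2..m2} \<subseteq> {1..m2}"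
    using assms by auto
  note counts = num_coprime_subsets_moebius[OF this]
    num_coprime_subsets_card_moebius[OF this \<open>0 < k\<close>]
  \<comment> \<open>Restricting \<open>d\<close> to the summation range supplies
    \<open>d > 0\<close>, as counting multiples requires.\<close>
  have "card {x \<in> {l1..m1} \<union> {l2..m2}. d dvd x} =
      m1 div d + m2 div d - (l1 - 1) div d - (l2 - 1) div d" if "d \<in> {1..m2}" for d
    using that assms by (intro card_multiples_two_intervals) auto
  then show ?thesis
    unfolding counts by (intro conjI sum.cong) simp_all
qed

end
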